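(* For all $n,m \in \mathbb{N}=\{0,1,2,\ldots\}$ with $n > m$, $$N_{n,m} = \int_0^1 P_n(2x-1)\,P_m(2x-1)\,\log(x)\,dx = \frac{(-1)^{n+m+1}}{(n-m)(n+m+1)}.$$
   Context: The Legendre polynomials $P_0,P_1,P_2,\ldots$ are defined by $P_0(x)=1$, $P_1(x)=x$, and for $n\geq 1$ by the three-term recurrence $(n+1)P_{n+1}(x) = (2n+1)\,x\,P_n(x) - n\,P_{n-1}(x)$. For $n,m\in\mathbb{N}$ define $N_{n,m} := \int_0^1 P_n(2x-1)\,P_m(2x-1)\,\log(x)\,dx$, where $\log$ is the natural logarithm. Here $\mathbb{N}$ includes $0$. *)

theory Defs
  imports "HOL-Analysis.Analysis" "HOL-Computational_Algebra.Polynomial"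
begin

(* The last equation is the three-term recurrence at index n + 1, solved for its leading term;
   see legendre_recurrence. *)
fun legendre :: "nat \<Rightarrow> real poly" where
  "legendre 0 = 1"
| "legendre (Suc 0) = [:0, 1:]"
| "legendre (Suc (Suc n)) =
     smult (1 / (real n + 2))
       (smult (2 * real n + 3) ([:0, 1:] * legendre (Suc n)) - smult (real n + 1) (legendre n))"

lemma legendre_recurrence:
  assumes "n \<ge> 1"
  shows "(real n + 1) * poly (legendre (n + 1)) x =
           (2 * real n + 1) * x * poly (legendre n) x - real n * poly (legendre (n - 1)) x"
proof -
  obtain k where n: "n = Suc k" using assms by (cases n) auto
  have "(real k + 2) * poly (legendre (Suc (Suc k))) x =
          (2 * real k + 3) * (x * poly (legendre (Suc k)) x) - (real k + 1) * poly (legendre k) x"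
    by simp
  then show ?thesis unfolding n by (simp add: algebra_simps del: legendre.simps)
qed

(* Lebesgue integral over the open interval (0, 1). The Bochner integral of a non-integrable
   function is 0, so a nonzero value entails integrability. *)
definition N :: "nat \<Rightarrow> nat \<Rightarrow> real" where
  "N n m = (LBINT x=0..1. poly (legendre n) (2 * x - 1) * poly (legendre m) (2 * x - 1) * ln x)"

end

theory Submission
  imports Defs
begin

text \<open>
  Write $p_n(x) = P_n(2x-1)$, $w(x) = x(1-x)$ and $W = p_n' p_m - p_n p_m'$. The Legendre equation
  $(w p_n')' = -n(n+1) p_n$ gives $(wW)' = -(n-m)(n+m+1) p_n p_m$, so integrating against
  $\log x$ by parts, with vanishing boundary terms, yields
  $(n-m)(n+m+1) N_{n,m} = \int_0^1 (1-x) W(x)\,dx$.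
  Since $(1-x) W = ((1-x) p_n p_m)' + p_n p_m - 2 (1-x) p_m' p_n$ and $p_n$ is orthogonal to all
  polynomials of degree less than $n$, the right-hand side is $-p_n(0) p_m(0) = (-1)^{n+m+1}$.
\<close>

section \<open>Derivative identities and the Legendre differential equation\<close>

text \<open>Both identities go through one induction because each feeds the other: the second one at
  \<open>n\<close> eliminates the oldest derivative from the differentiated three-term recurrence,
  giving the first at \<open>Suc n\<close>; that, the recurrence and both hypotheses then give the
  second.\<close>

lemma legendre_contiguous:
  "poly (pderiv (legendre (Suc n))) t = t * poly (pderiv (legendre n)) t + (real n + 1) * poly (legendre n) t \<and>
   t * poly (pderiv (legendre (Suc n))) t - poly (pderiv (legendre n)) t = (real n + 1) * poly (legendre (Suc n)) t"
proof (induction n)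
  case 0
  then show ?case by (simp add: pderiv_pCons)
next
  case (Suc n)
  define a b c where "a = poly (legendre n) t" and "b = poly (legendre (Suc n)) t"
    and "c = poly (legendre (Suc (Suc n))) t"
  define a' b' c' where "a' = poly (pderiv (legendre n)) t" and "b' = poly (pderiv (legendre (Suc n))) t"
    and "c' = poly (pderiv (legendre (Suc (Suc n)))) t"
  define k where "k = real n"
  have k: "k + 2 \<noteq> 0" by (simp add: k_def)
  have IH: "b' = t * a' + (k + 1) * a" "t * b' - a' = (k + 1) * b"
    using Suc unfolding a_def b_def a'_def b'_def k_def by auto
  have c: "(k + 2) * c = (2 * k + 3) * t * b - (k + 1) * a"
    unfolding a_def b_def c_def k_def by simp
  have "(k + 2) * c' = (2 * k + 3) * (b + t * b') - (k + 1) * a'"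
    unfolding a'_def b'_def b_def c'_def k_def
    by (simp add: pderiv_smult pderiv_diff pderiv_mult pderiv_pCons) (simp add: algebra_simps)
  also have "\<dots> = (k + 2) * (t * b' + (k + 2) * b)"
    using IH(2) by algebra
  finally have c': "c' = t * b' + (k + 2) * b"
    using k by simp
  moreover have "t * c' - b' = (k + 2) * c"
    unfolding c c' using IH by algebra
  ultimately show ?case
    unfolding b_def c_def b'_def c'_def k_def by (simp add: algebra_simps del: legendre.simps)
qed

text \<open>The first contiguous identity minus \<open>t\<close> times the second: the derivative of
  \<open>legendre n\<close> cancels.\<close>

lemma legendre_deriv:
  "[:1, 0, -1:] * pderiv (legendre (Suc n)) =
     smult (real n + 1) (legendre n - [:0, 1:] * legendre (Suc n))"
proof (rule poly_ext)
  fix t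
  show "poly ([:1, 0, -1:] * pderiv (legendre (Suc n))) t =
    poly (smult (real n + 1) (legendre n - [:0, 1:] * legendre (Suc n))) t"
    using legendre_contiguous[of n t] by (simp del: legendre.simps) algebra
qed

text \<open>Differentiating \<open>legendre_deriv\<close> leaves a derivative of the preceding
  polynomial, which the second contiguous identity eliminates.\<close>

lemma legendre_ode:
  "(1 - t\<^sup>2) * poly (pderiv (pderiv (legendre n))) t - 2 * t * poly (pderiv (legendre n)) t
     = - (real n * (real n + 1)) * poly (legendre n) t"
proof (cases n)
  case 0
  then show ?thesis by simp
next
  case (Suc k)
  define L L' L'' where "L = poly (legendre (Suc k)) t" and "L' = poly (pderiv (legendre (Suc k))) t"
    and "L'' = poly (pderiv (pderiv (legendre (Suc k)))) t"
  have "poly (pderiv ([:1, 0, -1:] * pderiv (legendre (Suc k)))) t =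
      (real k + 1) * (poly (pderiv (legendre k)) t - L - t * L')"
    unfolding legendre_deriv L_def L'_def
    by (simp add: pderiv_smult pderiv_diff pderiv_mult pderiv_pCons algebra_simps
        del: legendre.simps)
  also have "poly (pderiv (legendre k)) t = t * L' - (real k + 1) * L"
    using conjunct2[OF legendre_contiguous[of k t]] unfolding L_def L'_def by linarith
  finally have "(1 - t\<^sup>2) * L'' - 2 * t * L' = - ((real k + 1) * (real k + 2)) * L"
    unfolding pderiv_mult L_def L'_def L''_def
    by (simp add: pderiv_pCons power2_eq_square algebra_simps del: legendre.simps)
  then show ?thesis
    unfolding Suc L_def L'_def L''_def by (simp add: add_ac del: legendre.simps)
qed

lemma legendre_minus_one: "poly (legendre n) (-1) = (-1) ^ n"
proof (induction n rule: legendre.induct)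
  case (3 n)
  have "real n + 2 \<noteq> 0" by simp
  then show ?case using 3 by (simp add: divide_simps) (simp add: algebra_simps)
qed simp_all

lemma degree_legendre_le: "degree (legendre n) \<le> n"
proof (induction n rule: legendre.induct)
  case (3 n)
  have "degree ([:0, 1:] * legendre (Suc n)) \<le> Suc (Suc n)"
    using degree_mult_le[of "[:0, 1:]" "legendre (Suc n)"] 3 by simp
  moreover have "degree (legendre n) \<le> Suc (Suc n)" using 3 by simp
  ultimately show ?case
    unfolding legendre.simps
    by (intro order_trans[OF degree_smult_le] degree_diff_le) auto
qed simp_all

section \<open>Shifted Legendre polynomials on the unit interval\<close>

text \<open>Kept as a polynomial rather than a function, so that \<open>pderiv\<close> and
  \<open>degree\<close> apply to it.\<close>

definition shifted_legendre :: "nat \<Rightarrow> real poly" where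
  "shifted_legendre n = pcompose (legendre n) [:-1, 2:]"

lemma poly_shifted_legendre: "poly (shifted_legendre n) x = poly (legendre n) (2 * x - 1)"
  by (simp add: shifted_legendre_def poly_pcompose algebra_simps)

lemma shifted_legendre_0: "poly (shifted_legendre n) 0 = (-1) ^ n"
  by (simp add: poly_shifted_legendre legendre_minus_one)

lemma degree_shifted_legendre_le: "degree (shifted_legendre n) \<le> n"
  by (simp add: shifted_legendre_def degree_pcompose degree_legendre_le)

text \<open>With \<open>t = 2 * x - 1\<close> one has \<open>1 - t^2 = 4 * x * (1 - x)\<close>,
  which absorbs the chain-rule factor 4 of the second derivative; \<open>[:0, 1, -1:]\<close> is the
  weight \<open>x * (1 - x)\<close>.\<close>

lemma shifted_legendre_ode:
  "pderiv ([:0, 1, -1:] * pderiv (shifted_legendre n)) =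
     smult (- (real n * (real n + 1))) (shifted_legendre n)"
proof (rule poly_ext)
  fix x
  have "poly (pderiv (shifted_legendre n)) x = 2 * poly (pderiv (legendre n)) (2 * x - 1)"
    by (simp add: shifted_legendre_def pderiv_pcompose pderiv_pCons poly_pcompose algebra_simps)
  moreover have "poly (pderiv (pderiv (shifted_legendre n))) x =
      4 * poly (pderiv (pderiv (legendre n))) (2 * x - 1)"
    by (simp add: shifted_legendre_def pderiv_pcompose pderiv_pCons pderiv_smult poly_pcompose
        algebra_simps)
  ultimately show "poly (pderiv ([:0, 1, -1:] * pderiv (shifted_legendre n))) x =
    poly (smult (- (real n * (real n + 1))) (shifted_legendre n)) x"
    unfolding pderiv_mult using legendre_ode[of "2 * x - 1" n]
    by (simp add: pderiv_pCons poly_shifted_legendre power2_eq_square algebra_simps)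
qed

section \<open>Polynomial integrals: orthogonality and the Wronskian\<close>

lemma has_integral_poly_pderiv:
  "(poly (pderiv Q) has_integral poly Q 1 - poly Q 0) {0..1::real}"
  by (rule fundamental_theorem_of_calculus)
    (auto intro!: has_real_derivative_iff_has_vector_derivative[THEN iffD1]
      has_field_derivative_at_within poly_DERIV)

lemma pderiv_sum: "pderiv (sum f A) = (\<Sum>i\<in>A. pderiv (f i))"
  by (induction A rule: infinite_finite_induct) (simp_all add: pderiv_add)

lemma ex_pderiv_eq: "\<exists>Q. pderiv Q = (q :: real poly)"
proof
  show "pderiv (\<Sum>i\<le>degree q. monom (coeff q i / real (Suc i)) (Suc i)) = q"
    by (simp add: pderiv_sum pderiv_monom poly_as_sum_of_monoms)
qed

text \<open>
  Integrated over the unit interval, where the differentiated polynomial vanishes at both ends,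
  this is a two-term recursion in $k$ for the moments of $p_n$.
\<close>
lemma pderiv_shifted_legendre_moment:
  fixes n k :: nat
  defines "p \<equiv> shifted_legendre n"
  shows "pderiv (monom 1 k * ([:0, 1, -1:] * pderiv p - smult (real k) ([:1, -1:] * p))) =
     smult (real k * (real k + 1) - real n * (real n + 1)) (monom 1 k * p)
       - smult ((real k)\<^sup>2) (monom 1 (k - 1) * p)"
proof (rule poly_ext)
  fix x
  have ode: "poly (pderiv ([:0, 1, -1:] * pderiv p)) x = - (real n * (real n + 1)) * poly p x"
    using shifted_legendre_ode[of n] by (simp add: p_def)
  show "poly (pderiv (monom 1 k * ([:0, 1, -1:] * pderiv p - smult (real k) ([:1, -1:] * p)))) x =
    poly (smult (real k * (real k + 1) - real n * (real n + 1)) (monom 1 k * p)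
       - smult ((real k)\<^sup>2) (monom 1 (k - 1) * p)) x"
  proof (cases k)
    \<comment> \<open>The truncated exponent \<open>k - 1\<close> is harmless here, since its
      coefficient is zero.\<close>
    case 0
    then show ?thesis using ode by (simp add: pderiv_diff)
  next
    case (Suc j)
    show ?thesis
      using ode unfolding Suc pderiv_mult pderiv_diff pderiv_smult pderiv_monom
      by (simp add: pderiv_pCons poly_monom del: of_nat_Suc)
        (simp add: algebra_simps power2_eq_square del: of_nat_Suc)
  qed
qed

text \<open>The base case integrates the differential equation, whose eigenvalue is nonzero as
  \<open>n > 0\<close>. In the step the moment recursion expresses the next moment through one that
  vanishes by induction; its coefficient \<open>c\<close> is nonzero because the exponent stays
  below \<open>n\<close>.\<close>

lemma shifted_legendre_orthogonal_power:
  assumes "k < n"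
  shows "(poly (monom 1 k * shifted_legendre n) has_integral 0) {0..1}"
  using assms
proof (induction k)
  case 0
  define c where "c = - (real n * (real n + 1))"
  have "c \<noteq> 0" using 0 by (simp add: c_def add_eq_0_iff)
  have "((\<lambda>x. c * poly (monom 1 0 * shifted_legendre n) x) has_integral 0) {0..1}"
    using has_integral_poly_pderiv[of "[:0, 1, -1:] * pderiv (shifted_legendre n)"]
    unfolding shifted_legendre_ode by (simp flip: c_def poly_smult)
  from has_integral_mult_right[OF this, of "inverse c"] \<open>c \<noteq> 0\<close> show ?case
    by (simp flip: mult.assoc)
next
  case (Suc k)
  define c where "c = real (Suc k) * (real (Suc k) + 1) - real n * (real n + 1)"
  define p where "p = shifted_legendre n"
  have "real (Suc k) * (real (Suc k) + 1) < real n * (real n + 1)"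
    using Suc.prems by (intro mult_strict_mono) auto
  then have "c \<noteq> 0" by (simp add: c_def)
  define A where "A = monom 1 (Suc k) *
      ([:0, 1, -1:] * pderiv p - smult (real (Suc k)) ([:1, -1:] * p))"
  have "pderiv A = smult c (monom 1 (Suc k) * p) - smult ((real (Suc k))\<^sup>2) (monom 1 k * p)"
    using pderiv_shifted_legendre_moment[of "Suc k" n] by (simp only: A_def p_def c_def diff_Suc_1)
  then have "poly (pderiv A) =
      (\<lambda>x. c * poly (monom 1 (Suc k) * p) x - (real (Suc k))\<^sup>2 * poly (monom 1 k * p) x)"
    by (simp add: fun_eq_iff)
  moreover have "poly A 1 - poly A 0 = 0"
    by (simp add: A_def poly_monom)
  ultimately have "((\<lambda>x. c * poly (monom 1 (Suc k) * p) x - (real (Suc k))\<^sup>2 * poly (monom 1 k * p) x)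
      has_integral 0) {0..1}"
    using has_integral_poly_pderiv[of A] by simp
  moreover have "((\<lambda>x. (real (Suc k))\<^sup>2 * poly (monom 1 k * p) x) has_integral (real (Suc k))\<^sup>2 * 0) {0..1}"
    using Suc by (intro has_integral_mult_right) (simp add: p_def)
  ultimately have "((\<lambda>x. (c * poly (monom 1 (Suc k) * p) x - (real (Suc k))\<^sup>2 * poly (monom 1 k * p) x)
      + (real (Suc k))\<^sup>2 * poly (monom 1 k * p) x) has_integral 0 + (real (Suc k))\<^sup>2 * 0) {0..1}"
    by (rule has_integral_add)
  then have "((\<lambda>x. c * poly (monom 1 (Suc k) * p) x) has_integral 0) {0..1}"
    by (simp only: diff_add_cancel mult_zero_right add_0_right)
  from has_integral_mult_right[OF this, of "inverse c"] \<open>c \<noteq> 0\<close> show ?case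
    by (simp add: p_def flip: mult.assoc)
qed

lemma shifted_legendre_orthogonal:
  assumes "degree q < n"
  shows "(poly (q * shifted_legendre n) has_integral 0) {0..1}"
proof -
  have "poly (q * shifted_legendre n) =
    (\<lambda>x. \<Sum>i\<le>degree q. coeff q i * poly (monom 1 i * shifted_legendre n) x)"
    by (auto simp: fun_eq_iff poly_monom poly_altdef[of q] sum_distrib_right sum_distrib_left mult_ac)
  moreover have "((\<lambda>x. \<Sum>i\<le>degree q. coeff q i * poly (monom 1 i * shifted_legendre n) x)
      has_integral (\<Sum>i\<le>degree q. coeff q i * 0)) {0..1}"
    using assms by (intro has_integral_sum has_integral_mult_right shifted_legendre_orthogonal_power) auto
  ultimately show ?thesis by simp
qed

lemma shifted_legendre_wronskian_integral:
  fixes n m :: nat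
  defines "p \<equiv> shifted_legendre n" and "q \<equiv> shifted_legendre m"
  assumes "m < n"
  shows "(poly ([:1, -1:] * (pderiv p * q - p * pderiv q)) has_integral (-1) ^ (n + m + 1)) {0..1}"
proof -
  have "degree q < n"
    using degree_shifted_legendre_le[of m] assms by (simp add: q_def)
  \<comment> \<open>The factor \<open>1 - x\<close> only restores the degree lost by
    differentiating; for constant \<open>q\<close> the product is zero.\<close>
  moreover have "degree ([:1, -1:] * pderiv q) < n"
  proof (cases "degree q = 0")
    case True
    then show ?thesis using assms by (simp add: pderiv_eq_0_iff[THEN iffD2] del: mult_pCons_left)
  next
    case False
    then show ?thesis
      using \<open>degree q < n\<close> degree_mult_le[of "[:1, -1:]" "pderiv q"] by (simp add: degree_pderiv del: mult_pCons_left)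
  qed
  ultimately have "((\<lambda>x. poly (pderiv ([:1, -1:] * p * q)) x + poly (q * p) x
      - 2 * poly ([:1, -1:] * pderiv q * p) x) has_integral
        (poly ([:1, -1:] * p * q) 1 - poly ([:1, -1:] * p * q) 0) + 0 - 2 * 0) {0..1}"
    unfolding p_def
    by (intro has_integral_add has_integral_diff has_integral_mult_right
        has_integral_poly_pderiv shifted_legendre_orthogonal)
  \<comment> \<open>The factor \<open>1 - x\<close> kills the endpoint 1, so only the values at 0
    contribute.\<close>
  also have "(poly ([:1, -1:] * p * q) 1 - poly ([:1, -1:] * p * q) 0) + 0 - 2 * 0 = (-1) ^ (n + m + 1)"
    by (simp add: p_def q_def shifted_legendre_0 power_add)
  also have "(\<lambda>x. poly (pderiv ([:1, -1:] * p * q)) x + poly (q * p) x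
      - 2 * poly ([:1, -1:] * pderiv q * p) x) = poly ([:1, -1:] * (pderiv p * q - p * pderiv q))"
    unfolding pderiv_mult by (simp add: fun_eq_iff pderiv_pCons algebra_simps)
  finally show ?thesis .
qed

section \<open>The logarithm near 0 and integrability\<close>

text \<open>Substituting \<open>inverse x\<close> reduces the limit to that of
  \<open>ln x / x\<close> at infinity.\<close>

lemma tendsto_mult_ln_at_right_0: "((\<lambda>x::real. x * ln x) \<longlongrightarrow> 0) (at_right 0)"
proof (rule filterlim_at_right_to_top[THEN iffD2])
  have "((\<lambda>x::real. - (ln x / x)) \<longlongrightarrow> 0) at_top"
    using tendsto_minus[OF ln_x_over_x_tendsto_0] by simp
  then show "((\<lambda>x::real. inverse x * ln (inverse x)) \<longlongrightarrow> 0) at_top"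
    by (rule Lim_transform_eventually[OF _ eventually_mono[OF eventually_gt_at_top[of 0]]])
      (simp_all add: ln_inverse divide_inverse)
qed

text \<open>The sign is flipped because \<open>- ln x\<close> is nonnegative on the interval; finite
  one-sided limits of its antiderivative \<open>x - x * ln x\<close> then already force
  integrability.\<close>

lemma set_integrable_ln_unit: "set_integrable lborel {0<..<1} (ln :: real \<Rightarrow> real)"
proof -
  have "set_integrable lborel (einterval 0 1) (\<lambda>x. - ln x)"
  proof (rule interval_integral_FTC_nonneg(1))
    show "((\<lambda>x. x - x * ln x) has_real_derivative - ln x) (at x)"
      if "0 < ereal x" "ereal x < 1" for x
      using that by (auto intro!: derivative_eq_intros)
    show "(((\<lambda>x. x - x * ln x) \<circ> real_of_ereal) \<longlongrightarrow> 0) (at_right 0)"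
      unfolding zero_ereal_def ereal_tendsto_simps
      using tendsto_diff[OF tendsto_ident_at tendsto_mult_ln_at_right_0] by simp
    show "(((\<lambda>x. x - x * ln x) \<circ> real_of_ereal) \<longlongrightarrow> 1) (at_left 1)"
      unfolding one_ereal_def ereal_tendsto_simps by (auto intro!: tendsto_eq_intros)
  qed (auto intro!: continuous_intros)
  then show ?thesis
    by (simp add: set_integrable_def zero_ereal_def one_ereal_def)
qed

text \<open>A polynomial is bounded on the compact interval, so a constant multiple of
  \<open>ln\<close> dominates. No sign condition on \<open>q\<close> is involved, as suits the
  sign-changing integrands below.\<close>

lemma set_integrable_poly_ln:
  fixes q :: "real poly"
  shows "set_integrable lborel {0<..<1} (\<lambda>x. poly q x * ln x)"
proof -
  have "bounded (poly q ` {0..1})"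
    by (intro compact_imp_bounded compact_continuous_image continuous_on_poly continuous_on_id compact_Icc)
  then obtain B where B: "\<And>x. x \<in> {0..1} \<Longrightarrow> \<bar>poly q x\<bar> \<le> B"
    unfolding bounded_iff by fastforce
  show ?thesis
  proof (rule set_integrable_bound)
    show "set_integrable lborel {0<..<1} (\<lambda>x. B * ln x)"
      using set_integrable_ln_unit by (rule set_integrable_mult_right)
    have "(\<lambda>x. poly q x) \<in> borel_measurable borel"
      by (intro borel_measurable_continuous_onI continuous_intros)
    then show "set_borel_measurable lborel {0<..<1} (\<lambda>x. poly q x * ln x)"
      unfolding set_borel_measurable_def by measurable
    show "AE x in lborel. x \<in> {0<..<1} \<longrightarrow> norm (poly q x * ln x) \<le> norm (B * ln x)"
    proof (intro AE_I2 impI)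
      fix x :: real assume "x \<in> {0<..<1}"
      then have "\<bar>poly q x\<bar> \<le> \<bar>B\<bar>" using B[of x] by simp
      then show "norm (poly q x * ln x) \<le> norm (B * ln x)"
        by (simp add: abs_mult mult_right_mono)
    qed
  qed
qed

section \<open>Integration by parts against the logarithm\<close>

theorem theorem1:
  fixes n m :: nat
  assumes "n > m"
  shows "N n m = (-1) ^ (n + m + 1) / ((real n - real m) * (real n + real m + 1))"
proof -
  define p q where "p = shifted_legendre n" and "q = shifted_legendre m"
  define W where "W = pderiv p * q - p * pderiv q"
  define c where "c = (real n - real m) * (real n + real m + 1)"
  define R where "R = [:0, 1, -1:] * W"
  obtain Q where Q: "pderiv Q = [:1, -1:] * W" using ex_pderiv_eq by blast
  have Q_diff: "poly Q 1 - poly Q 0 = (-1) ^ (n + m + 1)"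
    using has_integral_poly_pderiv[of Q] shifted_legendre_wronskian_integral[OF assms]
    unfolding Q W_def p_def q_def by (rule has_integral_unique)
  \<comment> \<open>The two terms containing \<open>pderiv p * pderiv q\<close> cancel.\<close>
  have "pderiv R = pderiv ([:0, 1, -1:] * pderiv p) * q - p * pderiv ([:0, 1, -1:] * pderiv q)"
    unfolding R_def W_def pderiv_mult pderiv_diff by algebra
  also have "\<dots> = smult (- c) (p * q)"
    unfolding p_def q_def shifted_legendre_ode by (rule poly_ext) (simp add: c_def algebra_simps)
  finally have R_deriv: "pderiv R = smult (- c) (p * q)" .
  have R: "poly R x = x * (1 - x) * poly W x" for x
    by (simp add: R_def algebra_simps)
  \<comment> \<open>Integration by parts packed into one antiderivative: differentiating
    \<open>ln\<close> produces \<open>poly R x / x\<close>, which is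
    \<open>(1 - x) * poly W x\<close> and cancels against the derivative of
    \<open>Q\<close>.\<close>
  define F where "F = (\<lambda>x. poly Q x - poly R x * ln x)"
  have "(LBINT x=0..1. poly (smult c (p * q)) x * ln x) = poly Q 1 - poly Q 0"
  proof (rule interval_integral_FTC_integrable)
    fix x :: real assume "0 < ereal x" "ereal x < 1"
    then have x: "x > 0" by simp
    have "(F has_real_derivative poly (pderiv Q) x
        - (poly (pderiv R) x * ln x + 1 / x * poly R x)) (at x)"
      unfolding F_def using x by (intro DERIV_diff DERIV_mult poly_DERIV DERIV_ln_divide)
    also have "poly (pderiv Q) x - (poly (pderiv R) x * ln x + 1 / x * poly R x)
        = poly (smult c (p * q)) x * ln x"
      unfolding R_deriv Q R using x by (simp add: algebra_simps)
    finally show "(F has_vector_derivative poly (smult c (p * q)) x * ln x) (at x)"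
      by (simp only: has_real_derivative_iff_has_vector_derivative)
    show "isCont (\<lambda>x. poly (smult c (p * q)) x * ln x) x"
      using x by (intro continuous_intros) auto
  next
    show "set_integrable lborel (einterval 0 1) (\<lambda>x. poly (smult c (p * q)) x * ln x)"
      using set_integrable_poly_ln by (simp add: zero_ereal_def one_ereal_def del: poly_smult)
    \<comment> \<open>The factor \<open>x\<close> of \<open>R\<close> is moved onto
      \<open>ln x\<close>, where it tames the singularity at 0.\<close>
    have "((\<lambda>x. poly Q x - (1 - x) * poly W x * (x * ln x)) \<longlongrightarrow>
        poly Q 0 - (1 - 0) * poly W 0 * 0) (at_right 0)"
      by (intro tendsto_intros tendsto_mult_ln_at_right_0)
    then show "((F \<circ> real_of_ereal) \<longlongrightarrow> poly Q 0) (at_right 0)"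
      unfolding zero_ereal_def ereal_tendsto_simps F_def R by (simp add: comp_def mult_ac)
    have "(F \<longlongrightarrow> poly Q 1 - poly R 1 * ln 1) (at_left 1)"
      unfolding F_def by (intro tendsto_intros) auto
    then show "((F \<circ> real_of_ereal) \<longlongrightarrow> poly Q 1) (at_left 1)"
      unfolding one_ereal_def ereal_tendsto_simps by (simp add: comp_def)
  qed simp
  moreover have "(LBINT x=0..1. poly (smult c (p * q)) x * ln x) = c * N n m"
    unfolding N_def p_def q_def
    by (simp add: poly_shifted_legendre mult.assoc del: interval_lebesgue_integral_mult_right
        flip: interval_lebesgue_integral_mult_right)
  moreover have "c \<noteq> 0" using assms by (simp add: c_def)
  ultimately show ?thesis
    using Q_diff unfolding c_def[symmetric] by (simp add: field_simps)
qed

end
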